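(* Let $t\ge2$. The rate $\frac{1}{2^{t-1}}$ is MD-achievable for fingerprinting under the averaging attack with a coalition of size $t$; that is, there is an ensemble of codebooks such that for every $0<R<\frac{1}{2^{t-1}}$, with $M=\lfloor 2^{nR}\rfloor$ users, the misidentification probability $P_m$ under minimum distance (MD) decoding, averaged over the ensemble, goes to zero exponentially fast as $n\to\infty$.
   Context: Codebook: there are $M$ users; user $u\in\{1,\dots,M\}$ is assigned a fingerprint $f(u)\in\{-1,+1\}^n$, where $n$ is the code length. An ensemble of codebooks is a probability distribution, for each $n$ (and $R$), on codebooks of length $n$ with $M$ users. Averaging attack: a coalition $U$ of $t$ distinct users with fingerprints $\mathbf{x}_1,\dots,\mathbf{x}_t$ produces the forged copy $\mathbf{y}=\frac1t\sum_{i=1}^t\mathbf{x}_i$ (real addition). MD decoder: the decoder knows the codebook and $\mathbf{y}$. Positions $i$ with $y_i\ne\pm1$ are regarded as erased. The decoder finds the users whose fingerprint agrees with $\mathbf{y}$ in every unerased position and outputs such a user $g(\mathbf{y})$, chosen uniformly at random if there are several. Misidentification is the event $g(\mathbf{y})\notin U$. $P_m$ denotes the probability of misidentification averaged over the random codebook, over all $\binom{M}{t}$ coalitions $U$ of size $t$ (uniformly), and over the decoder's tie-breaking. A rate $R^*$ is called MD-achievable if for every $R<R^*$ and $M=2^{nR}$ the average $P_m$ over the ensemble, using MD decoding, goes exponentially to zero as $n\to\infty$. *)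

theory Defs
  imports "HOL-Probability.Probability"
begin

text \<open>A codebook \<open>f\<close> maps a user \<open>u\<close> and a position \<open>i\<close> to the symbol \<open>f u i\<close>. Symbols are reals, as
  forged copies are formed by real addition.\<close>

type_synonym codebook = "nat \<Rightarrow> nat \<Rightarrow> real"

definition codebooks :: "nat \<Rightarrow> nat \<Rightarrow> codebook set" where
  "codebooks n M = {1..M} \<rightarrow>\<^sub>E ({1..n} \<rightarrow>\<^sub>E {-1, 1})"

definition num_users :: "nat \<Rightarrow> real \<Rightarrow> nat" where
  "num_users n R = nat \<lfloor>2 powr (real n * R)\<rfloor>"

definition is_ensemble :: "(nat \<Rightarrow> real \<Rightarrow> codebook pmf) \<Rightarrow> bool" where
  "is_ensemble E \<longleftrightarrow> (\<forall>n R. set_pmf (E n R) \<subseteq> codebooks n (num_users n R))"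

definition coalitions :: "nat \<Rightarrow> nat \<Rightarrow> nat set set" where
  "coalitions M t = {U. U \<subseteq> {1..M} \<and> card U = t}"

definition averaging_attack :: "codebook \<Rightarrow> nat set \<Rightarrow> nat \<Rightarrow> real" where
  "averaging_attack f U = (\<lambda>i. (\<Sum>u\<in>U. f u i) / real (card U))"

definition unerased :: "nat \<Rightarrow> (nat \<Rightarrow> real) \<Rightarrow> nat set" where
  "unerased n y = {i \<in> {1..n}. y i = 1 \<or> y i = -1}"

definition md_candidates :: "nat \<Rightarrow> nat \<Rightarrow> codebook \<Rightarrow> (nat \<Rightarrow> real) \<Rightarrow> nat set" where
  "md_candidates n M f y = {u \<in> {1..M}. \<forall>i\<in>unerased n y. f u i = y i}"

text \<open>The candidate set is nonempty whenever \<open>y\<close> is the forged copy of a nonempty coalition, since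
  the members of the coalition are candidates; for other \<open>y\<close> the value may be unspecified.\<close>

definition md_decoder :: "nat \<Rightarrow> nat \<Rightarrow> codebook \<Rightarrow> (nat \<Rightarrow> real) \<Rightarrow> nat pmf" where
  "md_decoder n M f y = pmf_of_set (md_candidates n M f y)"

text \<open>Joint distribution of the coalition and the decoded user, and the probability that the latter
  is not in the former. For \<open>M < t\<close> there are no coalitions of size \<open>t\<close> and the value is unspecified;
  at a positive rate this happens only for finitely many \<open>n\<close>.\<close>

definition md_experiment ::
    "nat \<Rightarrow> nat \<Rightarrow> nat \<Rightarrow> codebook pmf \<Rightarrow> (nat set \<times> nat) pmf" where
  "md_experiment n M t D =
     bind_pmf D (\<lambda>f.
       bind_pmf (pmf_of_set (coalitions M t)) (\<lambda>U.
         map_pmf (\<lambda>g. (U, g)) (md_decoder n M f (averaging_attack f U))))"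

definition misid_prob :: "nat \<Rightarrow> nat \<Rightarrow> nat \<Rightarrow> codebook pmf \<Rightarrow> real" where
  "misid_prob n M t D = measure_pmf.prob (md_experiment n M t D) {(U, g). g \<notin> U}"

definition exponentially_to_zero :: "(nat \<Rightarrow> real) \<Rightarrow> bool" where
  "exponentially_to_zero p \<longleftrightarrow> (\<exists>c>0. \<forall>\<^sub>F n in sequentially. \<bar>p n\<bar> \<le> exp (- c * real n))"

definition md_achievable ::
    "(nat \<Rightarrow> real \<Rightarrow> codebook pmf) \<Rightarrow> nat \<Rightarrow> real \<Rightarrow> bool" where
  "md_achievable E t Rstar \<longleftrightarrow>
     (\<forall>R. 0 < R \<and> R < Rstar \<longrightarrow>
        exponentially_to_zero (\<lambda>n. misid_prob n (num_users n R) t (E n R)))"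

end

theory Submission
  imports Defs
begin

text \<open>
  The ensemble consists of independent uniformly distributed fingerprints. A position is unerased
  iff the coalition is unanimous there, which has probability \<open>p = 1 / 2 ^ (t - 1)\<close>. If \<open>w\<close>
  positions are unerased, a fixed innocent user is a candidate with probability \<open>2 ^ -w\<close>, so some
  innocent user is one with conditional probability at most \<open>min 1 (M * 2 ^ -w)\<close>. The plain union
  bound \<open>M * 2 ^ -w\<close> would lose rate after averaging over \<open>w\<close>; instead it is
  weakened to \<open>(M * 2 ^ -w) powr s\<close> with \<open>0 < s \<le> 1\<close>, whose average is
  \<open>M powr s * (1 - p + p * 2 powr -s) ^ n\<close>. For small \<open>s\<close> this decays exponentially at
  every rate below \<open>p\<close>.
\<close>

section \<open>Uniformly random codebooks and their product structure\<close>

definition random_words :: "nat \<Rightarrow> (nat \<Rightarrow> real) pmf" where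
  "random_words n = Pi_pmf {1..n} undefined (\<lambda>_. pmf_of_set {-1, 1})"

definition random_codebook :: "nat \<Rightarrow> nat set \<Rightarrow> codebook pmf" where
  "random_codebook n I = Pi_pmf I undefined (\<lambda>_. random_words n)"

lemma PiE_dflt_undefined: "PiE_dflt A undefined B = PiE A B"
  by (auto simp: PiE_dflt_def PiE_def Pi_def extensional_def)

lemma Pi_pmf_Pi_pmf_of_set:
  assumes "finite I" "finite J" "finite B" "B \<noteq> {}"
  shows "Pi_pmf I undefined (\<lambda>_. Pi_pmf J undefined (\<lambda>_. pmf_of_set B)) =
    pmf_of_set (I \<rightarrow>\<^sub>E (J \<rightarrow>\<^sub>E B))"
  using assms
  by (simp add: Pi_pmf_of_set PiE_dflt_undefined finite_PiE PiE_eq_empty_iff)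

text \<open>A codebook is drawn row by row, one fingerprint per user, whereas unanimity concerns a
  column. Both products are uniform on finite sets of matrices and transposition is a bijection
  between these sets, so the columns are independent as well.\<close>

lemma map_pmf_transpose_Pi_pmf:
  assumes "finite I" "finite J" "finite B" "B \<noteq> {}"
  shows "map_pmf (\<lambda>g. \<lambda>j\<in>J. \<lambda>i\<in>I. g i j)
      (Pi_pmf I undefined (\<lambda>_. Pi_pmf J undefined (\<lambda>_. pmf_of_set B))) =
    Pi_pmf J undefined (\<lambda>_. Pi_pmf I undefined (\<lambda>_. pmf_of_set B))"
proof -
  have "bij_betw (\<lambda>g. \<lambda>j\<in>J. \<lambda>i\<in>I. g i j) (I \<rightarrow>\<^sub>E (J \<rightarrow>\<^sub>E B)) (J \<rightarrow>\<^sub>E (I \<rightarrow>\<^sub>E B))"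
  proof (rule bij_betwI[where g = "\<lambda>h. \<lambda>i\<in>I. \<lambda>j\<in>J. h j i"])
    show "(\<lambda>i\<in>I. \<lambda>j\<in>J. (\<lambda>j\<in>J. \<lambda>i\<in>I. g i j) j i) = g" if "g \<in> I \<rightarrow>\<^sub>E (J \<rightarrow>\<^sub>E B)" for g
    proof (rule ext)
      fix i show "(\<lambda>i\<in>I. \<lambda>j\<in>J. (\<lambda>j\<in>J. \<lambda>i\<in>I. g i j) j i) i = g i"
        using that by (cases "i \<in> I") (auto simp: PiE_def extensional_def Pi_def restrict_def fun_eq_iff)
    qed
    show "(\<lambda>j\<in>J. \<lambda>i\<in>I. (\<lambda>i\<in>I. \<lambda>j\<in>J. h j i) i j) = h" if "h \<in> J \<rightarrow>\<^sub>E (I \<rightarrow>\<^sub>E B)" for h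
    proof (rule ext)
      fix j show "(\<lambda>j\<in>J. \<lambda>i\<in>I. (\<lambda>i\<in>I. \<lambda>j\<in>J. h j i) i j) j = h j"
        using that by (cases "j \<in> J") (auto simp: PiE_def extensional_def Pi_def restrict_def fun_eq_iff)
    qed
  qed (auto simp: PiE_def Pi_def)
  then show ?thesis
    using assms
    by (simp add: Pi_pmf_Pi_pmf_of_set map_pmf_of_set_bij_betw finite_PiE PiE_eq_empty_iff)
qed

lemma set_random_codebook: "set_pmf (random_codebook n {1..M}) = codebooks n M"
  unfolding random_codebook_def random_words_def codebooks_def
  by (subst Pi_pmf_Pi_pmf_of_set) (auto simp: finite_PiE PiE_eq_empty_iff)

text \<open>The event is a box, so its probability factors over the positions: \<open>1 / 2\<close>
  for each one in \<open>T\<close> and \<open>1\<close> for all others.\<close>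

lemma prob_random_words_agree:
  assumes "T \<subseteq> {1..n}" "\<And>i. i \<in> T \<Longrightarrow> y i \<in> {-1, 1}"
  shows "measure_pmf.prob (random_words n) {x. \<forall>i\<in>T. x i = y i} = (1 / 2) ^ card T"
proof -
  have "{x. \<forall>i\<in>T. x i = y i} = Pi {1..n} (\<lambda>i. if i \<in> T then {y i} else UNIV)"
    using assms(1) by (auto simp: Pi_def split: if_splits)
  then have "measure_pmf.prob (random_words n) {x. \<forall>i\<in>T. x i = y i} =
      (\<Prod>i\<in>{1..n}. measure_pmf.prob (pmf_of_set {-1, 1}) (if i \<in> T then {y i} else UNIV))"
    by (simp add: random_words_def measure_Pi_pmf_Pi)
  also have "\<dots> = (\<Prod>i\<in>{1..n}. if i \<in> T then 1 / 2 else 1)"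
  proof (rule prod.cong[OF refl])
    fix i
    show "measure_pmf.prob (pmf_of_set {-1, 1}) (if i \<in> T then {y i} else UNIV) =
      (if i \<in> T then 1 / 2 else 1)"
      using assms(2)[of i] by (auto simp: measure_pmf_of_set)
  qed
  also have "\<dots> = (1 / 2) ^ card T"
    using assms(1) by (simp add: prod.If_cases Int_absorb1)
  finally show ?thesis .
qed

section \<open>Innocent users agreeing with a fixed word\<close>

text \<open>An exponent \<open>s \<le> 1\<close> can only enlarge a number in \<open>[0, 1]\<close>,
  and a number above \<open>1\<close> keeps its power at least \<open>1\<close>. This merges the
  union bound and the trivial bound \<open>1\<close> into one expression that is multiplicative over
  positions.\<close>

lemma min_1_le_powr:
  fixes a s :: real
  assumes "a \<ge> 0" "0 < s" "s \<le> 1"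
  shows "min 1 a \<le> a powr s"
proof (cases "a \<le> 1")
  case True
  then show ?thesis
    using powr_mono'[of s 1 a] assms by (cases "a = 0") auto
next
  case False
  then show ?thesis using assms ge_one_powr_ge_zero[of a s] by simp
qed

lemma prob_innocent_candidate:
  assumes "finite V" "card V \<le> M" "T \<subseteq> {1..n}" "\<And>i. i \<in> T \<Longrightarrow> y i \<in> {-1, 1}" "0 < s" "s \<le> 1"
  shows "measure_pmf.prob (random_codebook n V) {h. \<exists>u\<in>V. \<forall>i\<in>T. h u i = y i}
    \<le> real M powr s * (2 powr - s) ^ card T"
proof -
  let ?P = "measure_pmf.prob (random_codebook n V)"
  have one: "?P {h. \<forall>i\<in>T. h u i = y i} = (1 / 2) ^ card T" if "u \<in> V" for u
  proof -
    have "?P {h. \<forall>i\<in>T. h u i = y i} =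
        measure_pmf.prob (map_pmf (\<lambda>h. h u) (random_codebook n V)) {x. \<forall>i\<in>T. x i = y i}"
      by simp
    also have "map_pmf (\<lambda>h. h u) (random_codebook n V) = random_words n"
      using assms(1) that by (simp add: random_codebook_def Pi_pmf_component)
    finally show ?thesis using prob_random_words_agree[OF assms(3,4)] by simp
  qed
  have "?P {h. \<exists>u\<in>V. \<forall>i\<in>T. h u i = y i} = ?P (\<Union>u\<in>V. {h. \<forall>i\<in>T. h u i = y i})"
    by (rule arg_cong[where f = ?P]) auto
  also have "\<dots> \<le> (\<Sum>u\<in>V. ?P {h. \<forall>i\<in>T. h u i = y i})"
    using assms(1) by (intro measure_pmf.finite_measure_subadditive_finite) auto
  also have "\<dots> = card V * (1 / 2) ^ card T"
    using one by simp
  also have "\<dots> \<le> M * (1 / 2) ^ card T"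
    using assms(2) by (intro mult_right_mono) auto
  \<comment> \<open>The union bound is capped at \<open>1\<close> because the left side is a
    probability.\<close>
  finally have "?P {h. \<exists>u\<in>V. \<forall>i\<in>T. h u i = y i} \<le> min 1 (M * (1 / 2) ^ card T)"
    by simp
  also have "\<dots> \<le> (M * (1 / 2) ^ card T) powr s"
    using assms by (intro min_1_le_powr) auto
  also have "\<dots> = real M powr s * (2 powr - s) ^ card T"
  proof -
    have "(1 / 2) ^ card T = 2 powr - real (card T)"
      by (simp add: powr_minus powr_realpow power_divide field_simps)
    then show ?thesis by (simp add: powr_mult powr_powr powr_power mult.commute)
  qed
  finally show ?thesis .
qed

section \<open>Unanimous columns of a coalition\<close>

text \<open>Formulated for a single column and without the average, so that its probability can be
  computed in a product of fair signs.\<close>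

definition unanimous :: "nat set \<Rightarrow> (nat \<Rightarrow> real) \<Rightarrow> bool" where
  "unanimous U x \<longleftrightarrow> (\<exists>b\<in>{-1, 1}. \<forall>u\<in>U. x u = b)"

lemma prob_unanimous:
  assumes "finite U" "card U = t" "t \<ge> 1"
  shows "measure_pmf.prob (Pi_pmf U undefined (\<lambda>_. pmf_of_set {-1, 1})) {x. unanimous U x} =
    1 / 2 ^ (t - 1)"
proof -
  let ?P = "measure_pmf.prob (Pi_pmf U undefined (\<lambda>_. pmf_of_set {-1, 1 :: real}))"
  have const: "?P (Pi U (\<lambda>_. {b})) = (1 / 2) ^ t" if "b \<in> {-1, 1}" for b
    using assms that by (auto simp: measure_Pi_pmf_Pi measure_pmf_of_set)
  \<comment> \<open>Over an empty \<open>U\<close> the two boxes below would coincide; a member of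
    \<open>U\<close> makes them disjoint.\<close>
  obtain u where "u \<in> U" using assms by fastforce
  have "{x. unanimous U x} = Pi U (\<lambda>_. {1}) \<union> Pi U (\<lambda>_. {-1})"
    by (auto simp: unanimous_def Pi_def)
  moreover have "Pi U (\<lambda>_. {1}) \<inter> Pi U (\<lambda>_. {-1 :: real}) = {}"
    using \<open>u \<in> U\<close> by (auto simp: Pi_def)
  ultimately have "?P {x. unanimous U x} = ?P (Pi U (\<lambda>_. {1})) + ?P (Pi U (\<lambda>_. {-1}))"
    by (simp add: measure_pmf.finite_measure_Union)
  also have "\<dots> = 2 * (1 / 2) ^ t" by (simp add: const)
  also have "\<dots> = 1 / 2 ^ (t - 1)"
    using assms(3) by (cases t) (auto simp: power_divide)
  finally show ?thesis .
qed

lemma nn_integral_if_pmf: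
  fixes a :: real
  assumes "0 \<le> a"
  shows "(\<integral>\<^sup>+x. ennreal (if P x then a else 1) \<partial>measure_pmf p) =
    ennreal (1 - measure_pmf.prob p {x. P x} + measure_pmf.prob p {x. P x} * a)"
proof -
  let ?A = "{x. P x}"
  have "(\<integral>\<^sup>+x. ennreal (if P x then a else 1) \<partial>measure_pmf p) =
      (\<integral>\<^sup>+x. ennreal a * indicator ?A x + indicator (- ?A) x \<partial>measure_pmf p)"
    by (intro nn_integral_cong) (auto simp: indicator_def)
  also have "\<dots> = ennreal a * emeasure p ?A + emeasure p (- ?A)"
    by (simp add: nn_integral_add nn_integral_cmult)
  also have "\<dots> = ennreal (measure_pmf.prob p ?A * a) + ennreal (1 - measure_pmf.prob p ?A)"
    using assms measure_pmf.prob_compl[of ?A p]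
    by (simp add: measure_pmf.emeasure_eq_measure ennreal_mult mult.commute Compl_eq_Diff_UNIV)
  also have "\<dots> = ennreal (1 - measure_pmf.prob p ?A + measure_pmf.prob p ?A * a)"
    using assms by (simp add: ennreal_plus[symmetric] add.commute del: ennreal_plus)
  finally show ?thesis .
qed

text \<open>The integrand has one factor per column. The columns are independent and identically
  distributed, so the mean of the product is the \<open>n\<close>-th power of the mean of one
  factor, which equals \<open>a\<close> with probability \<open>p\<close> and \<open>1\<close>
  otherwise.\<close>

lemma nn_integral_unanimous_columns:
  fixes a :: real
  assumes "finite U" "card U = t" "t \<ge> 1" "0 \<le> a"
  defines "p \<equiv> 1 / 2 ^ (t - 1)"
  shows "(\<integral>\<^sup>+g. (\<Prod>i\<in>{1..n}. ennreal (if unanimous U (\<lambda>u. g u i) then a else 1))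
      \<partial>measure_pmf (random_codebook n U)) = ennreal ((1 - p + p * a) ^ n)"
proof -
  define \<phi> where "\<phi> x = ennreal (if unanimous U x then a else 1)" for x
  let ?tr = "\<lambda>g :: codebook. \<lambda>i\<in>{1..n}. \<lambda>u\<in>U. g u i"
  have "(\<integral>\<^sup>+g. (\<Prod>i\<in>{1..n}. ennreal (if unanimous U (\<lambda>u. g u i) then a else 1))
        \<partial>measure_pmf (random_codebook n U)) =
      (\<integral>\<^sup>+g. (\<Prod>i\<in>{1..n}. \<phi> (?tr g i)) \<partial>measure_pmf (random_codebook n U))"
    \<comment> \<open>The restrictions in \<open>?tr\<close> are harmless: only positions in
      \<open>{1..n}\<close> and users in \<open>U\<close> are read.\<close>
    by (intro nn_integral_cong prod.cong) (auto simp: \<phi>_def unanimous_def)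
  also have "\<dots> =
      (\<integral>\<^sup>+c. (\<Prod>i\<in>{1..n}. \<phi> (c i)) \<partial>measure_pmf (map_pmf ?tr (random_codebook n U)))"
    by simp
  also have "map_pmf ?tr (random_codebook n U) =
      Pi_pmf {1..n} undefined (\<lambda>_. Pi_pmf U undefined (\<lambda>_. pmf_of_set {-1, 1}))"
    unfolding random_codebook_def random_words_def
    using assms by (intro map_pmf_transpose_Pi_pmf) auto
  also have "(\<integral>\<^sup>+c. (\<Prod>i\<in>{1..n}. \<phi> (c i)) \<partial>measure_pmf \<dots>) =
      (\<Prod>i\<in>{1..n}. \<integral>\<^sup>+x. \<phi> x \<partial>measure_pmf (Pi_pmf U undefined (\<lambda>_. pmf_of_set {-1, 1})))"
    by (rule nn_integral_prod_Pi_pmf) simp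
  also have "(\<integral>\<^sup>+x. \<phi> x \<partial>measure_pmf (Pi_pmf U undefined (\<lambda>_. pmf_of_set {-1, 1}))) =
      ennreal (1 - p + p * a)"
    unfolding \<phi>_def p_def
    by (simp only: nn_integral_if_pmf[OF assms(4)] prob_unanimous[OF assms(1-3)])
  also have "(\<Prod>i\<in>{1..n}. ennreal (1 - p + p * a)) = ennreal ((1 - p + p * a) ^ n)"
  proof -
    have "0 \<le> 1 - p + p * a" using assms(4) by (simp add: p_def)
    then show ?thesis by (simp add: ennreal_power del: ennreal_plus)
  qed
  finally show ?thesis .
qed

section \<open>The forged copy at unanimous and unerased positions\<close>

lemma unanimous_imp_averaging_attack:
  assumes "card U \<ge> 1" "\<forall>u\<in>U. f u i = b"
  shows "averaging_attack f U i = b"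
  using assms by (simp add: averaging_attack_def)

text \<open>An average of signs is extreme only if all of them are: since \<open>b * b = 1\<close>,
  the nonnegative terms \<open>1 - b * f u i\<close> sum to zero, hence each one vanishes.\<close>

lemma averaging_attack_imp_unanimous:
  assumes "finite U" "card U \<ge> 1" "\<And>u. u \<in> U \<Longrightarrow> f u i \<in> {-1, 1}"
    and "averaging_attack f U i = b" "b \<in> {-1, 1}" "u \<in> U"
  shows "f u i = b"
proof -
  have "(\<Sum>u\<in>U. 1 - b * f u i) = 0"
  proof -
    have "(\<Sum>u\<in>U. f u i) = b * card U"
      using assms(2,4) by (auto simp: averaging_attack_def)
    then show ?thesis
      using assms(5) by (auto simp: sum_subtractf simp flip: sum_distrib_left)
  qed
  moreover have "0 \<le> 1 - b * f v i" if "v \<in> U" for v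
    using assms(3)[OF that] assms(5) by auto
  ultimately have "1 - b * f u i = 0"
    using assms(1,6) by (simp add: sum_nonneg_eq_0_iff)
  then show ?thesis using assms(3)[OF assms(6)] assms(5) by auto
qed

lemma averaging_attack_cong:
  assumes "\<And>u. u \<in> U \<Longrightarrow> f u = g u"
  shows "averaging_attack f U = averaging_attack g U"
  using assms by (simp add: averaging_attack_def)

text \<open>Guarantees that the decoder chooses from a nonempty set. At an unerased position the
  coalition is unanimous, so each member agrees with the forged copy there.\<close>

lemma coalition_subset_md_candidates:
  assumes "f \<in> codebooks n M" "U \<subseteq> {1..M}" "card U \<ge> 1"
  shows "U \<subseteq> md_candidates n M f (averaging_attack f U)"
proof
  fix u assume u: "u \<in> U"
  have "f u i = averaging_attack f U i" if i: "i \<in> unerased n (averaging_attack f U)" for i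
  proof (rule averaging_attack_imp_unanimous[OF _ assms(3) _ refl _ u])
    show "finite U" using assms(2) finite_subset by blast
    show "f v i \<in> {-1, 1}" if "v \<in> U" for v
      using assms(1,2) i that by (fastforce simp: codebooks_def unerased_def PiE_def Pi_def)
    show "averaging_attack f U i \<in> {-1, 1}"
      using i by (auto simp: unerased_def)
  qed
  then show "u \<in> md_candidates n M f (averaging_attack f U)"
    using u assms(2) by (auto simp: md_candidates_def)
qed

section \<open>Bounding the misidentification probability\<close>

text \<open>The worst case over tie-breaking: an error is charged as soon as an innocent candidate
  exists.\<close>

definition misid_possible :: "nat \<Rightarrow> nat \<Rightarrow> nat set \<Rightarrow> codebook set" where
  "misid_possible n M U = {f. \<not> md_candidates n M f (averaging_attack f U) \<subseteq> U}"

text \<open>Condition on the coalition's rows \<open>g\<close>. They determine the forged copy,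
  while the innocent rows \<open>h\<close> remain independent and uniform, so
  \<open>prob_innocent_candidate\<close> applies with a fixed word; the resulting bound is then
  averaged over \<open>g\<close>.\<close>

lemma emeasure_misid_possible_le:
  assumes "U \<subseteq> {1..M}" "card U = t" "t \<ge> 1" "0 < s" "s \<le> 1"
  defines "p \<equiv> 1 / 2 ^ (t - 1)"
  shows "emeasure (random_codebook n {1..M}) (misid_possible n M U)
    \<le> ennreal (real M powr s * (1 - p + p * 2 powr - s) ^ n)"
proof -
  define V where "V = {1..M} - U"
  have fin: "finite U" "finite V" using assms(1) finite_subset unfolding V_def by auto
  have cV: "card V \<le> M" unfolding V_def using card_mono[of "{1..M}" "{1..M} - U"] by simp
  let ?m = "\<lambda>(g, h) u. if u \<in> U then g u else (h u :: nat \<Rightarrow> real)"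
  let ?G = "measure_pmf (random_codebook n U)" and ?H = "measure_pmf (random_codebook n V)"
  let ?T = "\<lambda>g. unerased n (averaging_attack g U)"
  have "{1..M} = U \<union> V" using assms(1) by (auto simp: V_def)
  then have "random_codebook n {1..M} = Pi_pmf (U \<union> V) undefined (\<lambda>_. random_words n)"
    by (simp only: random_codebook_def)
  also have "\<dots> = map_pmf ?m (pair_pmf (random_codebook n U) (random_codebook n V))"
    unfolding random_codebook_def using fin by (intro Pi_pmf_union) (auto simp: V_def)
  finally have "emeasure (random_codebook n {1..M}) (misid_possible n M U) =
      (\<integral>\<^sup>+g. emeasure ?H {h. ?m (g, h) \<in> misid_possible n M U} \<partial>?G)"
    by (simp add: pair_pmf_def map_pmf_def bind_assoc_pmf bind_return_pmf emeasure_return_pmf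
        indicator_def flip: nn_integral_indicator)
  also have "\<dots> \<le> (\<integral>\<^sup>+g. ennreal (real M powr s) *
      (\<Prod>i\<in>{1..n}. ennreal (if unanimous U (\<lambda>u. g u i) then 2 powr - s else 1)) \<partial>?G)"
  proof (rule nn_integral_mono)
    fix g
    have att: "averaging_attack (?m (g, h)) U = averaging_attack g U" for h
      by (rule averaging_attack_cong) simp
    have "{h. ?m (g, h) \<in> misid_possible n M U} =
        {h. \<exists>u\<in>V. \<forall>i\<in>?T g. h u i = averaging_attack g U i}"
      using att by (auto simp: misid_possible_def md_candidates_def V_def)
    then have "emeasure ?H {h. ?m (g, h) \<in> misid_possible n M U} =
        ennreal (measure_pmf.prob (random_codebook n V)
          {h. \<exists>u\<in>V. \<forall>i\<in>?T g. h u i = averaging_attack g U i})"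
      by (simp add: measure_pmf.emeasure_eq_measure)
    also have "\<dots> \<le> ennreal (real M powr s * (2 powr - s) ^ card (?T g))"
      using fin cV assms(4,5)
      by (intro ennreal_leI prob_innocent_candidate) (auto simp: unerased_def)
    \<comment> \<open>The power is spread over the positions to prepare for averaging column by
      column.\<close>
    also have "(2 powr - s) ^ card (?T g) = (\<Prod>i\<in>{1..n}. if i \<in> ?T g then 2 powr - s else 1)"
    proof -
      have "?T g \<subseteq> {1..n}" by (auto simp: unerased_def)
      then show ?thesis by (simp add: prod.If_cases Int_absorb1)
    qed
    also have "ennreal (real M powr s * \<dots>) \<le> ennreal (real M powr s *
        (\<Prod>i\<in>{1..n}. if unanimous U (\<lambda>u. g u i) then 2 powr - s else 1))"
    proof (intro ennreal_leI mult_left_mono prod_mono conjI)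
      fix i assume i: "i \<in> {1..n}"
      \<comment> \<open>Every unanimous position is unerased, and by
        \<open>2 powr - s \<le> 1\<close> any further unerased position only lowers the left side.
        Strict inequality can occur here, as \<open>g\<close> is arbitrary and may take values other
        than \<open>-1\<close> and \<open>1\<close>.\<close>
      have "i \<in> ?T g" if "unanimous U (\<lambda>u. g u i)"
        using that i assms(2,3) unanimous_imp_averaging_attack[of U g i]
        by (auto simp: unanimous_def unerased_def)
      moreover have "2 powr - s \<le> 1" using assms(4) powr_mono[of "- s" 0 2] by simp
      ultimately show "(if i \<in> ?T g then 2 powr - s else 1) \<le>
          (if unanimous U (\<lambda>u. g u i) then 2 powr - s else 1)"
        by auto
    qed auto
    also have "\<dots> = ennreal (real M powr s) *
      (\<Prod>i\<in>{1..n}. ennreal (if unanimous U (\<lambda>u. g u i) then 2 powr - s else 1))"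
      by (subst ennreal_mult) (auto simp: prod_ennreal intro!: prod_nonneg)
    finally show "emeasure ?H {h. ?m (g, h) \<in> misid_possible n M U} \<le> \<dots>" .
  qed
  also have "\<dots> = ennreal (real M powr s) * ennreal ((1 - p + p * 2 powr - s) ^ n)"
    using nn_integral_unanimous_columns[OF fin(1) assms(2,3), of "2 powr - s" n]
    by (simp add: nn_integral_cmult p_def)
  also have "\<dots> = ennreal (real M powr s * (1 - p + p * 2 powr - s) ^ n)"
    by (rule ennreal_mult[symmetric]) (auto simp: p_def)
  finally show ?thesis .
qed

text \<open>For a fixed coalition, the conditional error probability given the codebook is at most
  \<open>1\<close>, and it is \<open>0\<close> when all candidates are guilty. Averaging over
  coalitions preserves the uniform bound \<open>c\<close>.\<close>

lemma misid_prob_le: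
  assumes "t \<ge> 1" "t \<le> M" "set_pmf D \<subseteq> codebooks n M" "0 \<le> c"
    and "\<And>U. U \<in> coalitions M t \<Longrightarrow> emeasure D (misid_possible n M U) \<le> ennreal c"
  shows "misid_prob n M t D \<le> c"
proof -
  let ?W = "{(U, g). g \<notin> U}" and ?C = "pmf_of_set (coalitions M t)"
  let ?dec = "\<lambda>U f. map_pmf (\<lambda>g. (U, g)) (md_decoder n M f (averaging_attack f U))"
  have C: "finite (coalitions M t)" "coalitions M t \<noteq> {}"
    using obtain_subset_with_card_n[of t "{1..M}"] assms(2) by (auto simp: coalitions_def)
  \<comment> \<open>The coalition is drawn independently of the codebook, so it may be drawn
    first.\<close>
  have "md_experiment n M t D = bind_pmf ?C (\<lambda>U. bind_pmf D (?dec U))"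
    unfolding md_experiment_def by (rule bind_commute_pmf)
  then have "ennreal (misid_prob n M t D) =
      (\<integral>\<^sup>+U. (\<integral>\<^sup>+f. emeasure (?dec U f) ?W \<partial>measure_pmf D) \<partial>measure_pmf ?C)"
    by (simp add: misid_prob_def flip: measure_pmf.emeasure_eq_measure)
  also have "\<dots> \<le> (\<integral>\<^sup>+U. ennreal c \<partial>measure_pmf ?C)"
  proof (rule nn_integral_mono_AE, rule AE_pmfI)
    fix U assume "U \<in> set_pmf ?C"
    then have U: "U \<in> coalitions M t" using C by simp
    have "(\<integral>\<^sup>+f. emeasure (?dec U f) ?W \<partial>measure_pmf D) \<le>
        (\<integral>\<^sup>+f. indicator (misid_possible n M U) f \<partial>measure_pmf D)"
    proof (rule nn_integral_mono_AE, rule AE_pmfI)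
      fix f assume "f \<in> set_pmf D"
      then have f: "f \<in> codebooks n M" using assms(3) by auto
      let ?S = "md_candidates n M f (averaging_attack f U)"
      have "U \<subseteq> ?S"
        using U f assms(1) by (intro coalition_subset_md_candidates) (auto simp: coalitions_def)
      moreover have "U \<noteq> {}" using U assms(1) by (auto simp: coalitions_def)
      moreover have "finite ?S" by (simp add: md_candidates_def)
      \<comment> \<open>Finiteness and nonemptiness of \<open>?S\<close> ensure that
        \<open>pmf_of_set\<close> has exactly this support.\<close>
      ultimately have S: "set_pmf (md_decoder n M f (averaging_attack f U)) = ?S"
        unfolding md_decoder_def by (intro set_pmf_of_set) auto
      show "emeasure (?dec U f) ?W \<le> indicator (misid_possible n M U) f"
      proof (cases "f \<in> misid_possible n M U")
        case True
        then show ?thesis by (simp add: measure_pmf.subprob_emeasure_le_1)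
      next
        case False
        then have "set_pmf (?dec U f) \<inter> ?W = {}"
          using S by (auto simp: misid_possible_def)
        then have "measure_pmf.prob (?dec U f) ?W = 0"
          by (rule measure_pmf_zero_iff[THEN iffD2])
        then have "emeasure (?dec U f) ?W = 0"
          by (simp only: measure_pmf.emeasure_eq_measure ennreal_0)
        then show ?thesis by simp
      qed
    qed
    also have "\<dots> \<le> ennreal c" using assms(5)[OF U] by simp
    finally show "(\<integral>\<^sup>+f. emeasure (?dec U f) ?W \<partial>measure_pmf D) \<le> ennreal c" .
  qed
  also have "\<dots> = ennreal c" by simp
  finally show ?thesis using assms(4) by simp
qed

section \<open>Choice of the exponent and asymptotics\<close>

text \<open>With \<open>x = s * ln 2\<close> the claim reads
  \<open>R * x < p * (1 - exp (- x))\<close>, which to first order at \<open>0\<close> is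
  \<open>R < p\<close>. Quantitatively, \<open>1 - exp (- x) \<ge> x / (1 + x)\<close>, so
  \<open>R * (1 + x) < p\<close> suffices.\<close>

lemma exists_decay_exponent:
  fixes R p :: real
  assumes "0 < R" "R < p"
  shows "\<exists>s>0. s \<le> 1 \<and> R * (s * ln 2) < p * (1 - 2 powr - s)"
proof -
  \<comment> \<open>The bound \<open>ln 2\<close> yields \<open>s \<le> 1\<close>; the other term is
    half of the value at which \<open>R * (1 + x)\<close> reaches \<open>p\<close>.\<close>
  define x where "x = min (ln 2) ((p / R - 1) / 2)"
  have x: "0 < x" "x \<le> ln 2" using assms by (auto simp: x_def field_simps)
  have "x \<le> (p / R - 1) / 2" unfolding x_def by (rule min.cobounded2)
  also have "\<dots> < p / R - 1" using assms by (simp add: field_simps)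
  finally have Rx: "R * (1 + x) < p" using assms by (simp add: field_simps)
  have "exp (- x) \<le> 1 / (1 + x)"
    using exp_ge_add_one_self[of x] x by (simp add: exp_minus field_simps)
  then have "x / (1 + x) \<le> 1 - exp (- x)"
    using x by (simp add: field_simps)
  moreover have "R * x < p * (x / (1 + x))"
    using mult_strict_right_mono[OF Rx x(1)] x by (simp add: pos_less_divide_eq mult_ac)
  ultimately have "R * x < p * (1 - exp (- x))"
    using assms by (smt (verit) mult_left_mono)
  moreover have "2 powr - (x / ln 2) = exp (- x)" by (simp add: powr_def)
  ultimately show ?thesis
    using x by (intro exI[of _ "x / ln 2"]) auto
qed

lemma num_users_powr_le:
  assumes "0 \<le> s"
  shows "real (num_users n R) powr s \<le> exp (R * (s * ln 2) * real n)"
proof -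
  have "real (num_users n R) \<le> 2 powr (real n * R)"
    by (simp add: num_users_def of_nat_floor)
  then have "real (num_users n R) powr s \<le> (2 powr (real n * R)) powr s"
    using assms by (intro powr_mono2) auto
  also have "\<dots> = exp (R * (s * ln 2) * real n)"
    by (simp add: powr_powr powr_def mult_ac)
  finally show ?thesis .
qed

text \<open>Coalitions of size \<open>t\<close> exist for all large \<open>n\<close>, so the
  experiment is eventually well specified.\<close>

lemma eventually_num_users_ge:
  assumes "0 < R"
  shows "\<forall>\<^sub>F n in sequentially. t \<le> num_users n R"
proof -
  have "filterlim (\<lambda>n. real n * (R * ln 2)) at_top sequentially"
    using assms
    by (intro filterlim_at_top_mult_tendsto_pos[OF tendsto_const _ filterlim_real_sequentially]) simp
  then have "filterlim (\<lambda>n. exp (real n * (R * ln 2))) at_top sequentially"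
    by (rule filterlim_compose[OF exp_at_top])
  then have "\<forall>\<^sub>F n in sequentially. real t \<le> exp (real n * (R * ln 2))"
    by (simp add: filterlim_at_top)
  then show ?thesis
  proof eventually_elim
    case (elim n)
    then have "real t \<le> 2 powr (real n * R)" by (simp add: powr_def mult_ac)
    then show ?case unfolding num_users_def by (simp add: le_nat_floor)
  qed
qed

theorem corollary1:
  fixes t :: nat
  assumes "t \<ge> 2"
  shows "\<exists>E. is_ensemble E \<and> md_achievable E t (1 / 2 ^ (t - 1))"
proof (intro exI conjI)
  let ?E = "\<lambda>n R. random_codebook n {1..num_users n R}"
  let ?p = "1 / 2 ^ (t - 1) :: real"
  show "is_ensemble ?E" by (simp only: is_ensemble_def set_random_codebook) simp
  show "md_achievable ?E t ?p"
    unfolding md_achievable_def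
  proof (intro allI impI, elim conjE)
    fix R :: real assume R: "0 < R" "R < ?p"
    obtain s where s: "0 < s" "s \<le> 1" "R * (s * ln 2) < ?p * (1 - 2 powr - s)"
      using exists_decay_exponent[OF R] by blast
    \<comment> \<open>\<open>c\<close> is the decay rate gained from the unerased positions minus
      the growth rate of \<open>M powr s\<close>; it is positive by the choice of
      \<open>s\<close>.\<close>
    define c where "c = ?p * (1 - 2 powr - s) - R * (s * ln 2)"
    \<comment> \<open>\<open>q\<close> is the mean factor per position;
      \<open>1 + z \<le> exp z\<close> will turn \<open>q ^ n\<close> into an exponential in
      \<open>n\<close>.\<close>
    define q where "q = 1 - ?p + ?p * 2 powr - s"
    have q: "0 \<le> q" "q \<le> exp (- ?p * (1 - 2 powr - s))"
    proof -
      have "?p \<le> 1" by simp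
      then have "0 \<le> 1 - ?p" "0 \<le> ?p * 2 powr - s" by auto
      then show "0 \<le> q" unfolding q_def by linarith
      have "q = 1 + (- ?p * (1 - 2 powr - s))" unfolding q_def by algebra
      then show "q \<le> exp (- ?p * (1 - 2 powr - s))"
        using exp_ge_add_one_self[of "- ?p * (1 - 2 powr - s)"] by linarith
    qed
    have "\<forall>\<^sub>F n in sequentially.
        \<bar>misid_prob n (num_users n R) t (?E n R)\<bar> \<le> exp (- c * real n)"
      using eventually_num_users_ge[OF R(1), of t]
    proof eventually_elim
      case (elim n)
      let ?M = "num_users n R"
      have "misid_prob n ?M t (?E n R) \<le> real ?M powr s * q ^ n"
        using assms elim s(1,2) q(1)
        by (intro misid_prob_le)
          (auto simp only: set_random_codebook coalitions_def q_def mem_Collect_eq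
            intro!: emeasure_misid_possible_le mult_nonneg_nonneg zero_le_power powr_ge_zero)
      also have "\<dots> \<le> exp (R * (s * ln 2) * real n) * exp (- ?p * (1 - 2 powr - s)) ^ n"
        using s(1) q by (intro mult_mono num_users_powr_le power_mono) auto
      also have "\<dots> = exp (- c * real n)"
        by (simp add: c_def flip: exp_of_nat_mult exp_add) (simp add: algebra_simps)
      finally show ?case by (simp add: misid_prob_def)
    qed
    then show "exponentially_to_zero (\<lambda>n. misid_prob n (num_users n R) t (?E n R))"
      using s(3) unfolding exponentially_to_zero_def by (intro exI[of _ c]) (simp add: c_def)
  qed
qed

end
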